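(* Let $F=f+h$ be as in the context. The sequences $\{x_k\}_{k=0}^\infty$, $\{\varphi_k(x)\}_{k=0}^\infty$ and $\{\alpha_k\}_{k=0}^\infty$ generated by the algorithm ACUESA (described in the context), from any initial point $x_0\in\mathbb{R}^n$, form an Underestimate Sequence (UES) of $F$.
   Context: Setting: $F:=f+h$ on $\mathbb{R}^n$ (Euclidean norm), where $h:\mathbb{R}^n\to\mathbb{R}$ is convex (possibly nonsmooth) and $f:\mathbb{R}^n\to\mathbb{R}$ is continuously differentiable, $\mu$-strongly convex and $L$-smooth with $L>\mu>0$, i.e. for all $x,y\in\mathbb{R}^n$: $f(x)\ge f(y)+\langle\nabla f(y),x-y\rangle+\frac{\mu}{2}\|x-y\|^2$ and $f(x)\le f(y)+\langle\nabla f(y),x-y\rangle+\frac{L}{2}\|x-y\|^2$. Proximal gradient: $\mathrm{prox}_{h,L}(x):=\arg\min_u\{h(u)+\frac{L}{2}\|x-u\|^2\}$, $G_L(x):=L\left(x-\mathrm{prox}_{h,L}(x-\frac1L\nabla f(x))\right)$. For a point $x$: $x^+:=x-\frac1L G_L(x)$ and $x^{++}:=x-\frac1\mu G_L(x)$. For $x,y\in\mathbb{R}^n$ put $\varphi(x;y):=F(y^+)+\langle G_L(y),x-y\rangle+\frac{\mu}{2}\|x-y\|^2+\frac{1}{2L}\|G_L(y)\|^2$. Algorithm ACUESA (run without its stopping test, so that infinite sequences are produced): given $x_0$, set $\alpha_k=\sqrt{\mu/L}$ and $\beta_k=\frac{1}{1+\alpha_k}$ for all $k\ge 0$, $v_0=x_0^{++}$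 and $\varphi_0(x):=\varphi(x;x_0)$. For $k=0,1,2,\dots$: set $y_k=\beta_k x_k+(1-\beta_k)v_k$; $x_{k+1}=y_k-\frac1L G_L(y_k)$; $v_{k+1}=(1-\alpha_k)v_k+\alpha_k y_k^{++}$; $\varphi_{k+1}(x):=(1-\alpha_k)\varphi_k(x)+\alpha_k\varphi(x;y_k)$. Definition (UES). A series of sequences $\{x_k\}_{k=0}^\infty\subset\mathbb{R}^n$, $\{\phi_k(x)\}_{k=0}^\infty$ (real-valued functions on $\mathbb{R}^n$, each attaining its minimum) and $\{\alpha_k\}_{k=0}^\infty$ with $\alpha_k\in(0,1)$ for all $k\ge0$ is called an Underestimate Sequence (UES) of $F$ if for all $x\in\mathbb{R}^n$ and all $k\ge0$: (i) $\phi_k(x)\le F(x)$; and (ii) $F(x_{k+1})-\phi_{k+1}^*\le(1-\alpha_k)(F(x_k)-\phi_k^* )$, where $\phi_k^*:=\min_x\phi_k(x)$. *)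

theory Defs
  imports "HOL-Analysis.Analysis"
begin

definition gradient :: "('a::real_inner \<Rightarrow> real) \<Rightarrow> 'a \<Rightarrow> 'a" where
  "gradient f x = (THE g. GDERIV f x :> g)"

lemma gradient_eqI:
  fixes f :: "'a::real_inner \<Rightarrow> real"
  assumes "GDERIV f x :> g"
  shows "gradient f x = g"
  unfolding gradient_def
proof (rule the_equality)
  fix g' assume "GDERIV f x :> g'"
  with assms have eq: "(\<lambda>v. inner v g') = (\<lambda>v. inner v g)"
    unfolding gderiv_def by (rule has_derivative_unique[rotated])
  have "inner (g' - g) (g' - g) = 0"
    using fun_cong[OF eq, of "g' - g"] by (simp add: inner_diff_right)
  then show "g' = g" by simp
qed (fact assms)

lemma GDERIV_gradient:
  fixes f :: "'a::euclidean_space \<Rightarrow> real"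
  assumes "f differentiable (at x)"
  shows "GDERIV f x :> gradient f x"
proof -
  obtain D where D: "(f has_derivative D) (at x)"
    using assms by (auto simp: differentiable_def)
  then have "linear D" by (rule has_derivative_linear)
  have "D v = inner v (adjoint D 1)" for v
    using adjoint_works[OF \<open>linear D\<close>, of v 1] by simp
  then have "GDERIV f x :> adjoint D 1"
    using D unfolding gderiv_def by (metis (no_types, lifting) ext)
  then show ?thesis by (simp add: gradient_eqI)
qed

definition continuously_differentiable :: "('a::real_inner \<Rightarrow> real) \<Rightarrow> bool" where
  "continuously_differentiable f \<longleftrightarrow>
     (\<forall>x. f differentiable (at x)) \<and> continuous_on UNIV (gradient f)"

definition strongly_convex :: "real \<Rightarrow> ('a::real_inner \<Rightarrow> real) \<Rightarrow> bool" where
  "strongly_convex \<mu> f \<longleftrightarrow>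
     (\<forall>x y. f x \<ge> f y + inner (gradient f y) (x - y) + \<mu> / 2 * (norm (x - y))\<^sup>2)"

definition smooth_with :: "real \<Rightarrow> ('a::real_inner \<Rightarrow> real) \<Rightarrow> bool" where
  "smooth_with L f \<longleftrightarrow>
     (\<forall>x y. f x \<le> f y + inner (gradient f y) (x - y) + L / 2 * (norm (x - y))\<^sup>2)"

text \<open>For \<open>L > 0\<close> and a finite convex \<open>h\<close> on a Euclidean space the minimiser below
  exists and is unique, so \<^const>\<open>arg_min\<close> selects it.\<close>

definition prox :: "('a::real_inner \<Rightarrow> real) \<Rightarrow> real \<Rightarrow> 'a \<Rightarrow> 'a" where
  "prox h L x = arg_min (\<lambda>u. h u + L / 2 * (norm (x - u))\<^sup>2) (\<lambda>u. True)"

definition prox_grad ::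
  "('a::real_inner \<Rightarrow> real) \<Rightarrow> ('a \<Rightarrow> real) \<Rightarrow> real \<Rightarrow> 'a \<Rightarrow> 'a" where
  "prox_grad f h L x = L *\<^sub>R (x - prox h L (x - (1 / L) *\<^sub>R gradient f x))"

text \<open>The points \<open>x\<^sup>+\<close> and \<open>x\<^sup>+\<^sup>+\<close> are \<open>pg_step f h L L x\<close> and \<open>pg_step f h L \<mu> x\<close>: both use
  the proximal gradient with parameter \<open>L\<close> and differ only in the step length \<open>1 / c\<close>.\<close>

definition pg_step ::
  "('a::real_inner \<Rightarrow> real) \<Rightarrow> ('a \<Rightarrow> real) \<Rightarrow> real \<Rightarrow> real \<Rightarrow> 'a \<Rightarrow> 'a" where
  "pg_step f h L c x = x - (1 / c) *\<^sub>R prox_grad f h L x"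

text \<open>\<open>lower_model f h \<mu> L y\<close> is the function \<open>x \<mapsto> \<phi>(x; y)\<close> for \<open>F = f + h\<close>.\<close>

definition lower_model ::
  "('a::real_inner \<Rightarrow> real) \<Rightarrow> ('a \<Rightarrow> real) \<Rightarrow> real \<Rightarrow> real \<Rightarrow> 'a \<Rightarrow> 'a \<Rightarrow> real" where
  "lower_model f h \<mu> L y x =
     (f (pg_step f h L L y) + h (pg_step f h L L y))
     + inner (prox_grad f h L y) (x - y)
     + \<mu> / 2 * (norm (x - y))\<^sup>2
     + 1 / (2 * L) * (norm (prox_grad f h L y))\<^sup>2"

definition acuesa_alpha :: "real \<Rightarrow> real \<Rightarrow> nat \<Rightarrow> real" where
  "acuesa_alpha \<mu> L k = sqrt (\<mu> / L)"

definition acuesa_beta :: "real \<Rightarrow> real \<Rightarrow> nat \<Rightarrow> real" where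
  "acuesa_beta \<mu> L k = 1 / (1 + acuesa_alpha \<mu> L k)"

fun acuesa_x :: "('a::real_inner \<Rightarrow> real) \<Rightarrow> ('a \<Rightarrow> real) \<Rightarrow> real \<Rightarrow> real \<Rightarrow> 'a \<Rightarrow> nat \<Rightarrow> 'a"
  and acuesa_v :: "('a::real_inner \<Rightarrow> real) \<Rightarrow> ('a \<Rightarrow> real) \<Rightarrow> real \<Rightarrow> real \<Rightarrow> 'a \<Rightarrow> nat \<Rightarrow> 'a"
  and acuesa_y :: "('a::real_inner \<Rightarrow> real) \<Rightarrow> ('a \<Rightarrow> real) \<Rightarrow> real \<Rightarrow> real \<Rightarrow> 'a \<Rightarrow> nat \<Rightarrow> 'a"
where
  "acuesa_x f h \<mu> L x0 0 = x0"
| "acuesa_x f h \<mu> L x0 (Suc k) =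
     acuesa_y f h \<mu> L x0 k - (1 / L) *\<^sub>R prox_grad f h L (acuesa_y f h \<mu> L x0 k)"
| "acuesa_v f h \<mu> L x0 0 = pg_step f h L \<mu> x0"
| "acuesa_v f h \<mu> L x0 (Suc k) =
     (1 - acuesa_alpha \<mu> L k) *\<^sub>R acuesa_v f h \<mu> L x0 k
     + acuesa_alpha \<mu> L k *\<^sub>R pg_step f h L \<mu> (acuesa_y f h \<mu> L x0 k)"
| "acuesa_y f h \<mu> L x0 k =
     acuesa_beta \<mu> L k *\<^sub>R acuesa_x f h \<mu> L x0 k
     + (1 - acuesa_beta \<mu> L k) *\<^sub>R acuesa_v f h \<mu> L x0 k"

primrec acuesa_phi ::
  "('a::real_inner \<Rightarrow> real) \<Rightarrow> ('a \<Rightarrow> real) \<Rightarrow> real \<Rightarrow> real \<Rightarrow> 'a \<Rightarrow> nat \<Rightarrow> 'a \<Rightarrow> real" where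
  "acuesa_phi f h \<mu> L x0 0 = lower_model f h \<mu> L x0"
| "acuesa_phi f h \<mu> L x0 (Suc k) =
     (\<lambda>x. (1 - acuesa_alpha \<mu> L k) * acuesa_phi f h \<mu> L x0 k x
          + acuesa_alpha \<mu> L k * lower_model f h \<mu> L (acuesa_y f h \<mu> L x0 k) x)"

definition attains_min :: "('a \<Rightarrow> real) \<Rightarrow> bool" where
  "attains_min g \<longleftrightarrow> (\<exists>m. is_arg_min g (\<lambda>x. True) m)"

definition min_value :: "('a \<Rightarrow> real) \<Rightarrow> real" where
  "min_value g = (LEAST c. c \<in> range g)"

definition underestimate_sequence ::
  "('a \<Rightarrow> real) \<Rightarrow> (nat \<Rightarrow> 'a) \<Rightarrow> (nat \<Rightarrow> 'a \<Rightarrow> real) \<Rightarrow> (nat \<Rightarrow> real) \<Rightarrow> bool" where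
  "underestimate_sequence F x \<phi> \<alpha> \<longleftrightarrow>
     (\<forall>k. attains_min (\<phi> k)) \<and>
     (\<forall>k. 0 < \<alpha> k \<and> \<alpha> k < 1) \<and>
     (\<forall>k z. \<phi> k z \<le> F z) \<and>
     (\<forall>k. F (x (Suc k)) - min_value (\<phi> (Suc k))
            \<le> (1 - \<alpha> k) * (F (x k) - min_value (\<phi> k)))"

end

theory Submission
  imports Defs
begin

text \<open>
  Write \<open>F = f + h\<close>, \<open>g = prox_grad f h L y\<close> and \<open>\<alpha> = sqrt (\<mu> / L)\<close>.

  The models lie below \<open>F\<close> because \<open>g - \<nabla>f y\<close> is a subgradient of \<open>h\<close> at the prox point
  \<open>p = y - g / L\<close>: adding this subgradient inequality, strong convexity of \<open>f\<close> at \<open>y\<close> and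
  the smoothness bound between \<open>y\<close> and \<open>p\<close> makes \<open>\<nabla>f y\<close> cancel and leaves exactly
  \<open>lower_model f h \<mu> L y\<close> (\<open>lower_model_le\<close>). The functions \<open>acuesa_phi\<close> are convex
  combinations of such models, hence also below \<open>F\<close>. The subgradient inequality presupposes
  that the prox point really is a minimiser; existence follows by compactness, since a finite
  convex function decreases at most linearly (\<open>prox_minimizes\<close>, \<open>prox_subgradient\<close>).

  Every model is a parabola \<open>c + \<mu> / 2 * (norm (x - w))\<^sup>2\<close> with the same curvature \<open>\<mu>\<close> and
  vertex \<open>w = y - g / \<mu>\<close>. Parabolas of one curvature are closed under convex combination, and
  their vertices combine in the same way; this is why the algorithm's \<open>v\<close> tracks the
  minimiser of \<open>acuesa_phi\<close> (\<open>acuesa_phi_vertex_form\<close>) and gives a recursion for the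
  minimum values. In that recursion the choice \<open>\<alpha>\<^sup>2 = \<mu> / L\<close> turns the coefficient of
  \<open>(norm g)\<^sup>2\<close> into \<open>- (1 - \<alpha>) / (2 * L)\<close>, which the inequality between
  the model built at \<open>y\<close> and \<open>F\<close>, evaluated at the current \<open>x\<close>, compensates exactly, and the choice of \<open>\<beta>\<close> makes \<open>(x - y) + \<alpha> (v - y) = 0\<close>, so that the two
  terms linear in \<open>g\<close> cancel (\<open>estimate_gap_contracts\<close>).
\<close>

section \<open>Parabolas of equal curvature\<close>

lemma norm_add_scaleR_squared:
  fixes x g :: "'a::real_inner"
  shows "(norm (x + t *\<^sub>R g))\<^sup>2 = (norm x)\<^sup>2 + 2 * t * inner g x + t\<^sup>2 * (norm g)\<^sup>2"
  by (simp only: power2_norm_eq_inner inner_add_left inner_add_right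
      inner_scaleR_left inner_scaleR_right)
     (simp add: inner_commute power2_eq_square algebra_simps)

text \<open>The extra constant \<open>a * (1 - a) * m / 2 * (norm (v - w))\<^sup>2\<close> is the gain in the minimum value
  over the average of the two minimum values; the contraction of the gap rests on it.\<close>

lemma convex_combination_of_parabolas:
  fixes v w x :: "'a::real_inner"
  shows "(1 - a) * (c + m / 2 * (norm (x - v))\<^sup>2) + a * (d + m / 2 * (norm (x - w))\<^sup>2) =
    ((1 - a) * c + a * d + a * (1 - a) * m / 2 * (norm (v - w))\<^sup>2)
    + m / 2 * (norm (x - ((1 - a) *\<^sub>R v + a *\<^sub>R w)))\<^sup>2"
proof -
  have "(1 - a) * (norm (x - v))\<^sup>2 + a * (norm (x - w))\<^sup>2 =
    a * (1 - a) * (norm (v - w))\<^sup>2 + (norm (x - ((1 - a) *\<^sub>R v + a *\<^sub>R w)))\<^sup>2"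
    by (simp add: power2_norm_eq_inner inner_simps algebra_simps inner_commute)
  then have "m / 2 * ((1 - a) * (norm (x - v))\<^sup>2 + a * (norm (x - w))\<^sup>2) =
    m / 2 * (a * (1 - a) * (norm (v - w))\<^sup>2 + (norm (x - ((1 - a) *\<^sub>R v + a *\<^sub>R w)))\<^sup>2)"
    by simp
  then show ?thesis by (simp only: distrib_left mult.assoc mult.left_commute[of _ m])
      (simp add: field_simps del: scaleR_left_diff_distrib scaleR_diff_left)
qed

lemma parabola_attains_min:
  fixes v :: "'a::real_inner"
  assumes "0 \<le> m" and "\<And>x. q x = c + m / 2 * (norm (x - v))\<^sup>2"
  shows "attains_min q"
  unfolding attains_min_def using assms
  by (intro exI[of _ v]) (simp add: is_arg_min_linorder)

lemma parabola_min_value: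
  fixes v :: "'a::real_inner"
  assumes "0 \<le> m" and "\<And>x. q x = c + m / 2 * (norm (x - v))\<^sup>2"
  shows "min_value q = c"
  unfolding min_value_def
proof (rule Least_equality)
  show "c \<in> range q" using assms(2)[of v] by (intro image_eqI[of _ _ v]) auto
  show "c \<le> y" if "y \<in> range q" for y using that assms by auto
qed

section \<open>The proximal point\<close>

text \<open>Comparing a distant \<open>u\<close> with the point of the segment from \<open>x\<close> to \<open>u\<close> that lies on the
  unit sphere around \<open>x\<close> shows that \<open>h\<close> decreases at most linearly, so that the quadratic term
  eventually dominates; hence the minimum over a suitable ball is global.\<close>

lemma convex_plus_quadratic_has_minimizer:
  fixes h :: "'a::euclidean_space \<Rightarrow> real"
  assumes h: "convex_on UNIV h" and L: "0 < L"
  shows "\<exists>p. \<forall>u. h p + L / 2 * (norm (x - p))\<^sup>2 \<le> h u + L / 2 * (norm (x - u))\<^sup>2"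
proof -
  let ?q = "\<lambda>u. h u + L / 2 * (norm (x - u))\<^sup>2"
  have cont: "continuous_on UNIV h"
    using h by (intro convex_on_continuous) auto
  then have conth: "continuous_on S h" for S
    using continuous_on_subset by blast
  obtain a where a: "\<And>w. w \<in> cball x 1 \<Longrightarrow> h a \<le> h w"
    using continuous_attains_inf[OF compact_cball _ conth, of x 1] by fastforce
  \<comment> \<open>For \<open>norm (x - u) \<ge> R\<close> the quadratic term outweighs the largest possible linear decrease
    \<open>norm (x - u) * (h x - h a)\<close>, so such \<open>u\<close> cannot beat \<open>x\<close> itself.\<close>
  define R where "R = max 1 (2 * (h x - h a) / L)"
  have R1: "1 \<le> R" unfolding R_def by simp
  have "continuous_on (cball x R) ?q"
    by (intro continuous_intros conth)
  moreover have "cball x R \<noteq> {}" using R1 by simp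
  ultimately obtain p where p: "\<And>u. u \<in> cball x R \<Longrightarrow> ?q p \<le> ?q u"
    using continuous_attains_inf[OF compact_cball, of x R ?q] by blast
  have "?q p \<le> ?q u" for u
  proof (cases "u \<in> cball x R")
    case True
    then show ?thesis by (rule p)
  next
    case False
    define r where "r = norm (x - u)"
    have r: "R < r" using False by (simp add: r_def dist_norm)
    then have r1: "1 < r" using R1 by simp
    define w where "w = (1 - 1 / r) *\<^sub>R x + (1 / r) *\<^sub>R u"
    have "x - w = (1 / r) *\<^sub>R (x - u)" by (simp add: w_def algebra_simps)
    then have "norm (x - w) = 1" using r1 by (auto simp: r_def)
    then have "h a \<le> h w" by (intro a) (simp add: dist_norm)
    also have "h w \<le> (1 - 1 / r) * h x + 1 / r * h u"
      unfolding w_def using r1 convex_onD[OF h, of "1 / r" x u] by simp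
    finally have "r * h a \<le> r * ((1 - 1 / r) * h x + 1 / r * h u)"
      using r1 by (intro mult_left_mono) auto
    also have "\<dots> = (r - 1) * h x + h u" using r1 by (simp add: field_simps)
    finally have hu: "h x \<le> h u + r * (h x - h a)" by (simp add: algebra_simps)
    have "2 * (h x - h a) / L \<le> R" by (simp add: R_def)
    with r have "2 * (h x - h a) / L \<le> r" by simp
    then have "h x - h a \<le> L / 2 * r" using L by (simp add: field_simps)
    then have "r * (h x - h a) \<le> r * (L / 2 * r)" using r1 by (intro mult_left_mono) auto
    with hu have "h x \<le> ?q u" by (simp add: r_def power2_eq_square algebra_simps)
    moreover have "?q p \<le> ?q x" using R1 by (intro p) simp
    ultimately show ?thesis by simp
  qed
  then show ?thesis by blast
qed

lemma prox_minimizes: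
  fixes h :: "'a::euclidean_space \<Rightarrow> real"
  assumes "convex_on UNIV h" and "0 < L"
  shows "h (prox h L x) + L / 2 * (norm (x - prox h L x))\<^sup>2 \<le> h u + L / 2 * (norm (x - u))\<^sup>2"
proof -
  obtain p where "\<forall>u. h p + L / 2 * (norm (x - p))\<^sup>2 \<le> h u + L / 2 * (norm (x - u))\<^sup>2"
    using convex_plus_quadratic_has_minimizer[OF assms] by blast
  then have "is_arg_min (\<lambda>u. h u + L / 2 * (norm (x - u))\<^sup>2) (\<lambda>u. True) p"
    by (simp add: is_arg_min_linorder)
  then have "is_arg_min (\<lambda>u. h u + L / 2 * (norm (x - u))\<^sup>2) (\<lambda>u. True) (prox h L x)"
    unfolding prox_def arg_min_def by (rule someI)
  then show ?thesis by (simp add: is_arg_min_linorder)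
qed

text \<open>First-order optimality: along the segment from the prox point to \<open>u\<close>, minimality bounds
  the directional slope from below up to an error linear in the step \<open>t\<close>, which is then sent
  to \<open>0\<close>.\<close>

lemma prox_subgradient:
  fixes h :: "'a::euclidean_space \<Rightarrow> real"
  assumes h: "convex_on UNIV h" and L: "0 < L"
  shows "h (prox h L x) + inner (L *\<^sub>R (x - prox h L x)) (u - prox h L x) \<le> h u"
proof -
  define p where "p = prox h L x"
  define C where "C = L / 2 * (norm (u - p))\<^sup>2"
  have step: "h p + L * inner (x - p) (u - p) \<le> h u + t * C" if t: "0 < t" "t \<le> 1" for t
  proof -
    define w where "w = (1 - t) *\<^sub>R p + t *\<^sub>R u"
    have "x - w = (x - p) + (- t) *\<^sub>R (u - p)" by (simp add: w_def algebra_simps)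
    then have sq: "(norm (x - w))\<^sup>2
        = (norm (x - p))\<^sup>2 - 2 * t * inner (x - p) (u - p) + t\<^sup>2 * (norm (u - p))\<^sup>2"
      by (simp only: norm_add_scaleR_squared) (simp add: inner_commute)
    have "h p + L / 2 * (norm (x - p))\<^sup>2 \<le> h w + L / 2 * (norm (x - w))\<^sup>2"
      unfolding p_def by (rule prox_minimizes[OF h L])
    moreover have "h w \<le> (1 - t) * h p + t * h u"
      unfolding w_def using t convex_onD[OF h, of t p u] by simp
    ultimately have "t * (h p + L * inner (x - p) (u - p)) \<le> t * (h u + t * C)"
      unfolding sq C_def by (simp add: algebra_simps power2_eq_square)
    then show ?thesis using t by simp
  qed
  have "((\<lambda>t. h u + t * C) \<longlongrightarrow> h u + 0 * C) (at_right 0)"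
    by (intro tendsto_intros)
  moreover have "\<forall>\<^sub>F t in at_right 0. h p + L * inner (x - p) (u - p) \<le> h u + t * C"
    unfolding eventually_at_right_field using step by (intro exI[of _ 1]) simp
  ultimately have "h p + L * inner (x - p) (u - p) \<le> h u + 0 * C"
    by (intro tendsto_lowerbound) auto
  then show ?thesis by (simp add: p_def)
qed

section \<open>The lower model\<close>

lemma lower_model_le:
  fixes f h :: "'a::euclidean_space \<Rightarrow> real"
  assumes h: "convex_on UNIV h" and L: "0 < L"
    and sc: "strongly_convex \<mu> f" and sm: "smooth_with L f"
  shows "lower_model f h \<mu> L y x \<le> f x + h x"
proof -
  define d where "d = gradient f y"
  define g where "g = prox_grad f h L y"
  define p where "p = pg_step f h L L y"
  have p_eq: "p = prox h L (y - (1 / L) *\<^sub>R d)"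
    using L by (simp add: p_def pg_step_def prox_grad_def d_def)
  have pg: "p = y - (1 / L) *\<^sub>R g" by (simp add: p_def g_def pg_step_def)
  \<comment> \<open>The subgradient of \<open>h\<close> at the prox point of \<open>y - d / L\<close> is \<open>g - d\<close>; its summand \<open>- d\<close>
    cancels the gradient terms of the two bounds on \<open>f\<close>.\<close>
  have sub: "L *\<^sub>R (y - (1 / L) *\<^sub>R d - p) = g - d"
    using L by (simp add: pg algebra_simps)
  have hx: "h p + inner (g - d) (x - p) \<le> h x"
    using prox_subgradient[OF h L, of "y - (1 / L) *\<^sub>R d" x] unfolding p_eq[symmetric] sub .
  have fx: "f y + inner d (x - y) + \<mu> / 2 * (norm (x - y))\<^sup>2 \<le> f x"
    using sc by (simp add: strongly_convex_def d_def)
  have fp: "f p \<le> f y + inner d (p - y) + L / 2 * (norm (p - y))\<^sup>2"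
    using sm by (simp add: smooth_with_def d_def)
  have "L / 2 * (norm (p - y))\<^sup>2 = 1 / (2 * L) * (norm g)\<^sup>2"
    using L by (simp add: pg power2_eq_square field_simps)
  moreover have "inner g (x - p) = inner g (x - y) + 1 / L * (norm g)\<^sup>2"
    by (simp add: pg inner_diff_right power2_norm_eq_inner)
  moreover have "inner d (x - y) - inner d (p - y) = inner d (x - p)"
    by (simp add: inner_diff_right)
  ultimately show ?thesis
    using hx fx fp unfolding lower_model_def g_def[symmetric] p_def[symmetric]
    by (simp add: inner_diff_left)
qed

text \<open>Completing the square: the vertex of the model is the long step \<open>y - g / \<mu>\<close>, which is why
  the algorithm averages these points into \<open>v\<close>.\<close>

lemma lower_model_vertex_form:
  fixes f h :: "'a::real_inner \<Rightarrow> real"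
  assumes "0 < \<mu>"
  shows "lower_model f h \<mu> L y x =
    (f (pg_step f h L L y) + h (pg_step f h L L y)
       - (1 / \<mu> - 1 / L) / 2 * (norm (prox_grad f h L y))\<^sup>2)
    + \<mu> / 2 * (norm (x - pg_step f h L \<mu> y))\<^sup>2"
proof -
  define g where "g = prox_grad f h L y"
  have "x - pg_step f h L \<mu> y = (x - y) + (1 / \<mu>) *\<^sub>R g"
    by (simp add: pg_step_def g_def)
  then have "(norm (x - pg_step f h L \<mu> y))\<^sup>2
      = (norm (x - y))\<^sup>2 + 2 / \<mu> * inner g (x - y) + 1 / \<mu>\<^sup>2 * (norm g)\<^sup>2"
    by (simp only: norm_add_scaleR_squared) (simp add: power_divide)
  then show ?thesis
    unfolding lower_model_def g_def[symmetric]
    using assms by (simp add: field_simps power2_eq_square)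
qed

section \<open>The estimate sequence\<close>

lemma acuesa_phi_vertex_form:
  fixes f h :: "'a::real_inner \<Rightarrow> real"
  assumes "0 < \<mu>"
  shows "acuesa_phi f h \<mu> L x0 k x
    = min_value (acuesa_phi f h \<mu> L x0 k) + \<mu> / 2 * (norm (x - acuesa_v f h \<mu> L x0 k))\<^sup>2"
proof -
  have "\<exists>c. \<forall>x. acuesa_phi f h \<mu> L x0 k x = c + \<mu> / 2 * (norm (x - acuesa_v f h \<mu> L x0 k))\<^sup>2"
  proof (induction k)
    case 0
    show ?case using lower_model_vertex_form[OF assms, of f h L x0] by auto
  next
    case (Suc k)
    then obtain c where "\<forall>x. acuesa_phi f h \<mu> L x0 k x
        = c + \<mu> / 2 * (norm (x - acuesa_v f h \<mu> L x0 k))\<^sup>2" by blast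
    then show ?case
      by (simp only: acuesa_phi.simps acuesa_v.simps lower_model_vertex_form[OF assms]
          convex_combination_of_parabolas) blast
  qed
  then obtain c where
    c: "\<And>x. acuesa_phi f h \<mu> L x0 k x = c + \<mu> / 2 * (norm (x - acuesa_v f h \<mu> L x0 k))\<^sup>2"
    by blast
  moreover have "min_value (acuesa_phi f h \<mu> L x0 k) = c"
    using assms by (intro parabola_min_value[OF _ c]) simp
  ultimately show ?thesis by simp
qed

text \<open>The algebraic core. Here \<open>\<psi>\<close> is the current minimum value, \<open>X\<close> and \<open>P\<close> stand for
  \<open>F x\<close> and \<open>F (y - g / L)\<close>, and \<open>\<psi>'\<close> is the minimum value that the combination of two
  parabolas yields. The inequality is an identity up to nonnegative multiples of
  \<open>(norm (x - y))\<^sup>2\<close> and \<open>(norm (v - y))\<^sup>2\<close> and the slack in the model inequality.\<close>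

lemma estimate_gap_contracts:
  fixes x v y g :: "'a::real_inner"
  assumes \<mu>: "0 < \<mu>" and L: "0 < L" and a: "0 < a" "a < 1" and aa: "a\<^sup>2 = \<mu> / L"
    and y: "y = (1 / (1 + a)) *\<^sub>R x + (1 - 1 / (1 + a)) *\<^sub>R v"
    and model: "P + inner g (x - y) + \<mu> / 2 * (norm (x - y))\<^sup>2 + 1 / (2 * L) * (norm g)\<^sup>2 \<le> X"
    and \<psi>': "\<psi>' = (1 - a) * \<psi> + a * (P - (1 / \<mu> - 1 / L) / 2 * (norm g)\<^sup>2)
      + a * (1 - a) * \<mu> / 2 * (norm (v - (y - (1 / \<mu>) *\<^sub>R g)))\<^sup>2"
  shows "P - \<psi>' \<le> (1 - a) * (X - \<psi>)"
proof -
  have "(1 + a) *\<^sub>R y = x + a *\<^sub>R v"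
    using a by (simp add: y scaleR_add_right field_simps)
  then have "(x - y) + a *\<^sub>R (v - y) = 0"
    by (simp add: algebra_simps)
  then have "inner g ((x - y) + a *\<^sub>R (v - y)) = 0" by simp
  then have lin: "inner g (x - y) = - a * inner g (v - y)"
    by (simp only: inner_add_right inner_scaleR_right)
  have "v - (y - (1 / \<mu>) *\<^sub>R g) = (v - y) + (1 / \<mu>) *\<^sub>R g" by simp
  then have sq: "(norm (v - (y - (1 / \<mu>) *\<^sub>R g)))\<^sup>2
      = (norm (v - y))\<^sup>2 + 2 / \<mu> * inner g (v - y) + 1 / \<mu>\<^sup>2 * (norm g)\<^sup>2"
    by (simp only: norm_add_scaleR_squared) (simp add: power_divide)
  \<comment> \<open>Eliminating \<open>\<mu>\<close> merges \<open>a / (2 * L) - a\<^sup>2 / (2 * \<mu>)\<close>, the coefficient of \<open>(norm g)\<^sup>2\<close>,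
    into \<open>- (1 - a) / (2 * L)\<close>.\<close>
  have \<mu>_eq: "\<mu> = a\<^sup>2 * L" using aa L by simp
  have "\<psi>' = (1 - a) * \<psi> + a * P + a * (1 - a) * inner g (v - y)
      - (1 - a) / (2 * L) * (norm g)\<^sup>2 + (1 - a) * (a * \<mu> / 2 * (norm (v - y))\<^sup>2)"
    unfolding \<psi>' sq unfolding \<mu>_eq using a L
    by (simp add: field_simps power2_eq_square)
  moreover have "0 \<le> (1 - a) * (a * \<mu> / 2 * (norm (v - y))\<^sup>2)"
    using a \<mu> by simp
  ultimately have "P - \<psi>' - (1 - a) * (X - \<psi>)
      \<le> (1 - a) * (P - a * inner g (v - y) + 1 / (2 * L) * (norm g)\<^sup>2 - X)"
    by (simp add: algebra_simps diff_divide_distrib)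
  also have "\<dots> \<le> 0"
  proof -
    have "0 \<le> \<mu> / 2 * (norm (x - y))\<^sup>2" using \<mu> by simp
    with a model lin show ?thesis by (intro mult_nonneg_nonpos) auto
  qed
  finally show ?thesis by simp
qed

theorem theorem2:
  fixes f h :: "real ^ 'n \<Rightarrow> real"
    and \<mu> L :: real
    and x0 :: "real ^ 'n"
  assumes "convex_on UNIV h"
    and "continuously_differentiable f"
    and "0 < \<mu>" and "\<mu> < L"
    and "strongly_convex \<mu> f"
    and "smooth_with L f"
  shows "underestimate_sequence (\<lambda>x. f x + h x)
           (acuesa_x f h \<mu> L x0) (acuesa_phi f h \<mu> L x0) (acuesa_alpha \<mu> L)"
proof -
  define a where "a = sqrt (\<mu> / L)"
  have \<mu>: "0 < \<mu>" and L: "0 < L" using assms by auto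
  have alpha: "acuesa_alpha \<mu> L k = a" for k by (simp add: acuesa_alpha_def a_def)
  have a: "0 < a" "a < 1" using assms by (auto simp: a_def)
  have aa: "a\<^sup>2 = \<mu> / L" using assms by (simp add: a_def)
  let ?x = "acuesa_x f h \<mu> L x0" and ?v = "acuesa_v f h \<mu> L x0" and ?y = "acuesa_y f h \<mu> L x0"
  let ?\<phi> = "acuesa_phi f h \<mu> L x0"
  note model_le = lower_model_le[OF assms(1) L assms(5,6)]
  note \<phi>_form = acuesa_phi_vertex_form[OF \<mu>, of f h L x0]
  have \<phi>_le: "?\<phi> k z \<le> f z + h z" for k z
  proof (induction k)
    case 0
    show ?case using model_le by simp
  next
    case (Suc k)
    have "?\<phi> (Suc k) z \<le> (1 - a) * (f z + h z) + a * (f z + h z)"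
      unfolding acuesa_phi.simps alpha using a Suc.IH model_le
      by (intro add_mono mult_left_mono) auto
    then show ?case by (simp add: algebra_simps)
  qed
  have gap: "f (?x (Suc k)) + h (?x (Suc k)) - min_value (?\<phi> (Suc k))
      \<le> (1 - a) * (f (?x k) + h (?x k) - min_value (?\<phi> k))" for k
  proof -
    define g where "g = prox_grad f h L (?y k)"
    let ?p = "pg_step f h L L (?y k)"
    have x_Suc: "?x (Suc k) = ?p" by (simp add: pg_step_def)
    have step_\<mu>: "pg_step f h L \<mu> (?y k) = ?y k - (1 / \<mu>) *\<^sub>R g"
      by (simp add: pg_step_def g_def)
    have "?\<phi> (Suc k) z
      = ((1 - a) * min_value (?\<phi> k) + a * (f ?p + h ?p - (1 / \<mu> - 1 / L) / 2 * (norm g)\<^sup>2)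
         + a * (1 - a) * \<mu> / 2 * (norm (?v k - (?y k - (1 / \<mu>) *\<^sub>R g)))\<^sup>2)
        + \<mu> / 2 * (norm (z - ((1 - a) *\<^sub>R ?v k + a *\<^sub>R (?y k - (1 / \<mu>) *\<^sub>R g))))\<^sup>2" for z
      unfolding acuesa_phi.simps alpha lower_model_vertex_form[OF \<mu>]
        \<phi>_form[of k z] step_\<mu> g_def[symmetric] by (rule convex_combination_of_parabolas)
    then have min_Suc: "min_value (?\<phi> (Suc k))
      = (1 - a) * min_value (?\<phi> k) + a * (f ?p + h ?p - (1 / \<mu> - 1 / L) / 2 * (norm g)\<^sup>2)
         + a * (1 - a) * \<mu> / 2 * (norm (?v k - (?y k - (1 / \<mu>) *\<^sub>R g)))\<^sup>2"
      using \<mu> by (intro parabola_min_value) auto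
    have y: "?y k = (1 / (1 + a)) *\<^sub>R ?x k + (1 - 1 / (1 + a)) *\<^sub>R ?v k"
      by (simp add: acuesa_beta_def alpha)
    have "f ?p + h ?p + inner g (?x k - ?y k) + \<mu> / 2 * (norm (?x k - ?y k))\<^sup>2
        + 1 / (2 * L) * (norm g)\<^sup>2 \<le> f (?x k) + h (?x k)"
      using model_le[of "?y k" "?x k"] unfolding lower_model_def g_def .
    then show ?thesis
      unfolding x_Suc by (rule estimate_gap_contracts[OF \<mu> L a aa y _ min_Suc])
  qed
  have "attains_min (?\<phi> k)" for k
    using \<mu> by (intro parabola_attains_min[OF _ \<phi>_form]) simp
  then show ?thesis
    unfolding underestimate_sequence_def alpha using a \<phi>_le gap by blast
qed

end
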